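(* A moment category is the same as a category with moment structure in which all moments split. That is, on a given category $\mathbb{C}$ there is a one-to-one correspondence between active/inert factorisation systems satisfying (M1) and (M2), and moment structures in which all moments split. The correspondence takes a factorisation system to its moments together with the pushforward $f_*(\phi)=\psi_{in}\psi_{act}$, where for a moment $\phi=\phi_{in}\phi_{act}$ of $A$ and $f:A\to B$, $\psi_{in}$ is the inert part of $f\phi_{in}$ and $\psi_{act}$ is its unique active retraction; conversely it takes a moment structure to its classes of active and inert morphisms.
   Context: A class of morphisms is closed if it is closed under composition and contains all isomorphisms. An active/inert factorisation system on a category consists of two closed classes, of active and of inert morphisms, such that every morphism factors as $f=f_{in}f_{act}$ ($f_{act}$ active, $f_{in}$ inert), and for two such factorisations $f_{in}f_{act}=f'_{in}f'_{act}$ there is a unique isomorphism $h$ with $f_{in}=f'_{in}h$, $hf_{act}=f'_{act}$. A moment category is a category with an active/inert factorisation system such that (M1) every inert morphism has a unique active retraction; (M2) if $fi=g$ with $i$ inert and $f,g$ active, then $f=gr$ where $r$ is the unique active retraction of $i$. A moment of $A$ in a moment category is an endomorphism $\phi=\phi_{in}\phi_{act}$ of $A$ ($\phi_{act}:A\to B$, $\phi_{in}:B\to A$) with $\phi_{act}\phi_{in}=1_B$. A moment structure on a category consists in specifying for each object $A$ a set $m_A$ of endomorphisms of $A$, called moments, and for each morphism $f:A\to B$ a pushforward operation $f_*:m_A\to m_B$ such that, for all $A$, $\phi,\psi\in m_A$, $f:A\to B$, $g:B\to C$: (m1) $1_A\in m_A$; (m2) $\phi_*(\psi)=\phi\psi$;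 (m3) $(gf)_*=g_*f_*$; (m4) $f\phi=f_*(\phi)f$. In a category with moment structure, a morphism $f:A\to B$ is active if $f_*(1_A)=1_B$, and inert if $f$ admits a retraction $r:B\to A$ such that $f_*(\phi)=f\phi r$ for all $\phi\in m_A$. A moment $\phi$ of $A$ splits (over $B$) if there are $i:B\to A$, $r:A\to B$ with $ir=\phi$ and $ri=1_B$. *)

theory Defs
  imports Main "HOL-Library.FuncSet"
begin

section \<open>Categories\<close>

text \<open>Composition is written in applicative order: \<open>g \<cdot> f\<close> is \<open>g\<close> after \<open>f\<close>. It is only
  meaningful for composable morphisms of the category.\<close>

record ('o, 'm) category_data =
  Ob :: "'o set"
  Mor :: "'m set"
  Dom :: "'m \<Rightarrow> 'o"
  Cod :: "'m \<Rightarrow> 'o"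
  Ide :: "'o \<Rightarrow> 'm"  ("\<one>\<index>")
  Comp :: "'m \<Rightarrow> 'm \<Rightarrow> 'm"  (infixl "\<cdot>\<index>" 70)

definition hom :: "('o, 'm) category_data \<Rightarrow> 'o \<Rightarrow> 'o \<Rightarrow> 'm set" where
  "hom C A B = {f \<in> Mor C. Dom C f = A \<and> Cod C f = B}"

locale category =
  fixes C :: "('o, 'm) category_data" (structure)
  assumes dom_ob: "f \<in> Mor C \<Longrightarrow> Dom C f \<in> Ob C"
    and cod_ob: "f \<in> Mor C \<Longrightarrow> Cod C f \<in> Ob C"
    and ide_hom: "A \<in> Ob C \<Longrightarrow> \<one> A \<in> hom C A A"
    and comp_hom: "f \<in> hom C A B \<Longrightarrow> g \<in> hom C B D \<Longrightarrow> g \<cdot> f \<in> hom C A D"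
    and comp_ide_right: "f \<in> hom C A B \<Longrightarrow> f \<cdot> \<one> A = f"
    and comp_ide_left: "f \<in> hom C A B \<Longrightarrow> \<one> B \<cdot> f = f"
    and comp_assoc: "f \<in> hom C A B \<Longrightarrow> g \<in> hom C B D \<Longrightarrow> h \<in> hom C D E
      \<Longrightarrow> (h \<cdot> g) \<cdot> f = h \<cdot> (g \<cdot> f)"

definition retraction :: "('o, 'm) category_data \<Rightarrow> 'm \<Rightarrow> 'm \<Rightarrow> bool" where
  "retraction C r f \<longleftrightarrow> f \<in> Mor C \<and> r \<in> hom C (Cod C f) (Dom C f)
    \<and> r \<cdot>\<^bsub>C\<^esub> f = \<one>\<^bsub>C\<^esub> (Dom C f)"

definition iso :: "('o, 'm) category_data \<Rightarrow> 'm \<Rightarrow> bool" where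
  "iso C f \<longleftrightarrow> f \<in> Mor C \<and> (\<exists>g \<in> hom C (Cod C f) (Dom C f).
    g \<cdot>\<^bsub>C\<^esub> f = \<one>\<^bsub>C\<^esub> (Dom C f) \<and> f \<cdot>\<^bsub>C\<^esub> g = \<one>\<^bsub>C\<^esub> (Cod C f))"

definition closed_class :: "('o, 'm) category_data \<Rightarrow> 'm set \<Rightarrow> bool" where
  "closed_class C K \<longleftrightarrow> K \<subseteq> Mor C
    \<and> (\<forall>f \<in> K. \<forall>g \<in> K. Cod C f = Dom C g \<longrightarrow> g \<cdot>\<^bsub>C\<^esub> f \<in> K)
    \<and> (\<forall>f. iso C f \<longrightarrow> f \<in> K)"

section \<open>Active/inert factorisation systems and moment categories\<close>

record 'm factorisation_data =
  Act :: "'m set"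
  Inr :: "'m set"

definition factorises :: "('o, 'm) category_data \<Rightarrow> 'm factorisation_data
    \<Rightarrow> 'm \<Rightarrow> 'm \<Rightarrow> 'm \<Rightarrow> bool" where
  "factorises C F f f_in f_act \<longleftrightarrow> f_in \<in> Inr F \<and> f_act \<in> Act F
    \<and> Cod C f_act = Dom C f_in \<and> f = f_in \<cdot>\<^bsub>C\<^esub> f_act"

locale factorisation_system = category C
  for C :: "('o, 'm) category_data" (structure) +
  fixes F :: "'m factorisation_data"
  assumes active_closed: "closed_class C (Act F)"
    and inert_closed: "closed_class C (Inr F)"
    and factorisation_exists: "f \<in> Mor C \<Longrightarrow> \<exists>f_in f_act. factorises C F f f_in f_act"
    and factorisation_unique: "factorises C F f f_in f_act \<Longrightarrow> factorises C F f f_in' f_act'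
      \<Longrightarrow> \<exists>!h. iso C h \<and> h \<in> hom C (Cod C f_act) (Cod C f_act')
            \<and> f_in = f_in' \<cdot> h \<and> h \<cdot> f_act = f_act'"

definition active_retraction :: "('o, 'm) category_data \<Rightarrow> 'm factorisation_data
    \<Rightarrow> 'm \<Rightarrow> 'm \<Rightarrow> bool" where
  "active_retraction C F r i \<longleftrightarrow> r \<in> Act F \<and> retraction C r i"

locale moment_category = factorisation_system C F
  for C :: "('o, 'm) category_data" (structure) and F :: "'m factorisation_data" +
  assumes M1: "i \<in> Inr F \<Longrightarrow> \<exists>!r. active_retraction C F r i"
    and M2: "i \<in> Inr F \<Longrightarrow> f \<in> Act F \<Longrightarrow> g \<in> Act F \<Longrightarrow> Cod C i = Dom C f \<Longrightarrow> f \<cdot> i = g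
      \<Longrightarrow> active_retraction C F r i \<Longrightarrow> f = g \<cdot> r"

definition fs_moments :: "('o, 'm) category_data \<Rightarrow> 'm factorisation_data
    \<Rightarrow> 'o \<Rightarrow> 'm set" where
  "fs_moments C F A = {\<phi> \<in> hom C A A. A \<in> Ob C \<and> (\<exists>\<phi>_in \<phi>_act. factorises C F \<phi> \<phi>_in \<phi>_act
    \<and> \<phi>_act \<cdot>\<^bsub>C\<^esub> \<phi>_in = \<one>\<^bsub>C\<^esub> (Dom C \<phi>_in))}"

text \<open>The graph of the pushforward. Factorisations are only unique up to isomorphism, so they are
  chosen existentially; \<open>fs_pushes_unique\<close> below shows that the result depends on no choice.\<close>

definition fs_pushes :: "('o, 'm) category_data \<Rightarrow> 'm factorisation_data
    \<Rightarrow> 'm \<Rightarrow> 'm \<Rightarrow> 'm \<Rightarrow> bool" where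
  "fs_pushes C F f \<phi> \<psi> \<longleftrightarrow> (\<exists>\<phi>_in \<phi>_act \<psi>_in e \<psi>_act.
      factorises C F \<phi> \<phi>_in \<phi>_act
    \<and> factorises C F (f \<cdot>\<^bsub>C\<^esub> \<phi>_in) \<psi>_in e
    \<and> active_retraction C F \<psi>_act \<psi>_in
    \<and> \<psi> = \<psi>_in \<cdot>\<^bsub>C\<^esub> \<psi>_act)"

definition fs_push :: "('o, 'm) category_data \<Rightarrow> 'm factorisation_data
    \<Rightarrow> 'm \<Rightarrow> 'm \<Rightarrow> 'm" where
  "fs_push C F f \<phi> = (THE \<psi>. fs_pushes C F f \<phi> \<psi>)"

section \<open>Moment structures\<close>

text \<open>Since equality of moment structures matters, the data carry no junk: there are no moments
  outside the objects of the category, and \<open>push M f\<close> is \<open>undefined\<close> off the moments of the domain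
  of \<open>f\<close>, as is \<open>push M\<close> off the morphisms.\<close>

record ('o, 'm) moment_data =
  moments :: "'o \<Rightarrow> 'm set"
  push :: "'m \<Rightarrow> 'm \<Rightarrow> 'm"

locale moment_structure = category C
  for C :: "('o, 'm) category_data" (structure) +
  fixes M :: "('o, 'm) moment_data"
  assumes moments_endo: "A \<in> Ob C \<Longrightarrow> moments M A \<subseteq> hom C A A"
    and moments_outside: "A \<notin> Ob C \<Longrightarrow> moments M A = {}"
    and push_fun: "f \<in> hom C A B \<Longrightarrow> push M f \<in> moments M A \<rightarrow>\<^sub>E moments M B"
    and push_outside: "push M \<in> extensional (Mor C)"
    and m1: "A \<in> Ob C \<Longrightarrow> \<one> A \<in> moments M A"
    and m2: "A \<in> Ob C \<Longrightarrow> \<phi> \<in> moments M A \<Longrightarrow> \<psi> \<in> moments M A \<Longrightarrow> push M \<phi> \<psi> = \<phi> \<cdot> \<psi>"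
    and m3: "f \<in> hom C A B \<Longrightarrow> g \<in> hom C B D \<Longrightarrow> \<phi> \<in> moments M A
      \<Longrightarrow> push M (g \<cdot> f) \<phi> = push M g (push M f \<phi>)"
    and m4: "f \<in> hom C A B \<Longrightarrow> \<phi> \<in> moments M A \<Longrightarrow> f \<cdot> \<phi> = push M f \<phi> \<cdot> f"

definition splits :: "('o, 'm) category_data \<Rightarrow> 'o \<Rightarrow> 'm \<Rightarrow> bool" where
  "splits C A \<phi> \<longleftrightarrow> (\<exists>B \<in> Ob C. \<exists>i \<in> hom C B A. \<exists>r \<in> hom C A B.
    i \<cdot>\<^bsub>C\<^esub> r = \<phi> \<and> r \<cdot>\<^bsub>C\<^esub> i = \<one>\<^bsub>C\<^esub> B)"

locale split_moment_structure = moment_structure C M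
  for C :: "('o, 'm) category_data" (structure) and M :: "('o, 'm) moment_data" +
  assumes moments_split: "A \<in> Ob C \<Longrightarrow> \<phi> \<in> moments M A \<Longrightarrow> splits C A \<phi>"

definition ms_active :: "('o, 'm) category_data \<Rightarrow> ('o, 'm) moment_data \<Rightarrow> 'm set" where
  "ms_active C M = {f \<in> Mor C. push M f (\<one>\<^bsub>C\<^esub> (Dom C f)) = \<one>\<^bsub>C\<^esub> (Cod C f)}"

definition ms_inert :: "('o, 'm) category_data \<Rightarrow> ('o, 'm) moment_data \<Rightarrow> 'm set" where
  "ms_inert C M = {f \<in> Mor C. \<exists>r. retraction C r f
    \<and> (\<forall>\<phi> \<in> moments M (Dom C f). push M f \<phi> = f \<cdot>\<^bsub>C\<^esub> \<phi> \<cdot>\<^bsub>C\<^esub> r)}"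

section \<open>The correspondence\<close>

definition moment_structure_of :: "('o, 'm) category_data \<Rightarrow> 'm factorisation_data
    \<Rightarrow> ('o, 'm) moment_data" where
  "moment_structure_of C F = \<lparr>moments = fs_moments C F,
    push = (\<lambda>f \<in> Mor C. \<lambda>\<phi> \<in> fs_moments C F (Dom C f). fs_push C F f \<phi>)\<rparr>"

definition factorisation_system_of :: "('o, 'm) category_data \<Rightarrow> ('o, 'm) moment_data
    \<Rightarrow> 'm factorisation_data" where
  "factorisation_system_of C M = \<lparr>Act = ms_active C M, Inr = ms_inert C M\<rparr>"

section \<open>The pushforward is well defined\<close>

context moment_category
begin

lemma comp_in_Mor:
  "f \<in> Mor C \<Longrightarrow> g \<in> Mor C \<Longrightarrow> Cod C f = Dom C g \<Longrightarrow>
    g \<cdot> f \<in> Mor C \<and> Dom C (g \<cdot> f) = Dom C f \<and> Cod C (g \<cdot> f) = Cod C g"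
  using comp_hom[of f "Dom C f" "Cod C f" g "Cod C g"] by (simp add: hom_def)

lemma assoc_Mor:
  "f \<in> Mor C \<Longrightarrow> g \<in> Mor C \<Longrightarrow> h \<in> Mor C \<Longrightarrow> Cod C f = Dom C g \<Longrightarrow> Cod C g = Dom C h \<Longrightarrow>
    (h \<cdot> g) \<cdot> f = h \<cdot> (g \<cdot> f)"
  using comp_assoc[of f "Dom C f" "Cod C f" g "Cod C g" h "Cod C h"] by (simp add: hom_def)

lemma Act_Mor: "f \<in> Act F \<Longrightarrow> f \<in> Mor C"
  and Inr_Mor: "f \<in> Inr F \<Longrightarrow> f \<in> Mor C"
  and iso_Act: "iso C f \<Longrightarrow> f \<in> Act F"
  and Act_comp: "f \<in> Act F \<Longrightarrow> g \<in> Act F \<Longrightarrow> Cod C f = Dom C g \<Longrightarrow> g \<cdot> f \<in> Act F"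
  using active_closed inert_closed by (auto simp: closed_class_def)

lemma isoE:
  assumes "iso C h"
  obtains g where "iso C g" "g \<in> hom C (Cod C h) (Dom C h)"
    "g \<cdot> h = \<one> (Dom C h)" "h \<cdot> g = \<one> (Cod C h)"
  using assms by (auto simp: iso_def hom_def)

lemma retract_idem_iso_invariant:
  assumes j: "j \<in> Inr F" and s: "active_retraction C F s j"
    and h: "iso C h" "Cod C h = Dom C j" and r: "active_retraction C F r (j \<cdot> h)"
    and jh: "j \<cdot> h \<in> Inr F"
  shows "(j \<cdot> h) \<cdot> r = j \<cdot> s"
proof -
  obtain g where g: "iso C g" "g \<in> hom C (Cod C h) (Dom C h)"
    "g \<cdot> h = \<one> (Dom C h)" "h \<cdot> g = \<one> (Cod C h)" using h(1) by (rule isoE)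
  have jM: "j \<in> Mor C" using j Inr_Mor by blast
  have hM: "h \<in> Mor C" using h by (simp add: iso_def)
  have gM: "g \<in> Mor C" "Dom C g = Cod C h" "Cod C g = Dom C h" using g by (auto simp: hom_def)
  have sM: "s \<in> Mor C" "Dom C s = Cod C j" "Cod C s = Dom C j" "s \<cdot> j = \<one> (Dom C j)" "s \<in> Act F"
    using s by (auto simp: active_retraction_def retraction_def hom_def)
  have jhM: "j \<cdot> h \<in> Mor C" "Dom C (j \<cdot> h) = Dom C h" "Cod C (j \<cdot> h) = Cod C j"
    using comp_in_Mor[of h j] jM hM h(2) by auto
  have gsM: "g \<cdot> s \<in> Mor C" "Dom C (g \<cdot> s) = Cod C j" "Cod C (g \<cdot> s) = Dom C h"
    using comp_in_Mor[of s g] gM sM h(2) by auto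
  have "(g \<cdot> s) \<cdot> (j \<cdot> h) = g \<cdot> (s \<cdot> (j \<cdot> h))"
    using assoc_Mor[of "j \<cdot> h" s g] gM sM jhM h(2) by auto
  also have "s \<cdot> (j \<cdot> h) = (s \<cdot> j) \<cdot> h" using assoc_Mor[of h j s] sM jM hM h(2) by auto
  also have "\<dots> = h" using sM h(2) hM comp_ide_left[of h "Dom C h" "Cod C h"] by (simp add: hom_def)
  finally have "active_retraction C F (g \<cdot> s) (j \<cdot> h)"
    using g(1,3) gsM jhM gM sM h(2) Act_comp[of s g] iso_Act
    by (auto simp: active_retraction_def retraction_def hom_def)
  then have "r = g \<cdot> s" using M1[OF jh] r by blast
  then have "(j \<cdot> h) \<cdot> r = j \<cdot> (h \<cdot> (g \<cdot> s))"
    using assoc_Mor[of "g \<cdot> s" h j] gsM hM jM h(2) by auto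
  also have "h \<cdot> (g \<cdot> s) = (h \<cdot> g) \<cdot> s" using assoc_Mor[of s g h] sM gM hM h(2) by auto
  also have "\<dots> = s" using g(4) sM h(2) comp_ide_left[of s "Cod C j" "Dom C j"] by (simp add: hom_def)
  finally show ?thesis .
qed

lemma fs_pushes_unique:
  assumes f: "f \<in> Mor C" and \<phi>: "\<phi> \<in> hom C (Dom C f) (Dom C f)"
  shows "\<exists>!\<psi>. fs_pushes C F f \<phi> \<psi>"
proof (rule ex_ex1I)
  have dom: "i \<in> Mor C \<and> a \<in> Mor C \<and> Cod C i = Cod C x"
    if "factorises C F x i a" for x i a
    using that comp_in_Mor[of a i] Act_Mor Inr_Mor by (auto simp: factorises_def)
  obtain i a where ia: "factorises C F \<phi> i a"
    using factorisation_exists[of \<phi>] \<phi> by (auto simp: hom_def)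
  have "f \<cdot> i \<in> Mor C" using dom[OF ia] f \<phi> comp_in_Mor[of i f] by (auto simp: hom_def)
  then obtain k e where ke: "factorises C F (f \<cdot> i) k e" using factorisation_exists by blast
  then have "k \<in> Inr F" by (simp add: factorises_def)
  then obtain r where "active_retraction C F r k" using M1 by blast
  with ia ke show "\<exists>\<psi>. fs_pushes C F f \<phi> \<psi>" unfolding fs_pushes_def by blast
next
  fix \<psi> \<psi>'
  assume "fs_pushes C F f \<phi> \<psi>" "fs_pushes C F f \<phi> \<psi>'"
  then obtain i a k e r i' a' k' e' r' where
    1: "factorises C F \<phi> i a" "factorises C F (f \<cdot> i) k e" "active_retraction C F r k" "\<psi> = k \<cdot> r"
    and 2: "factorises C F \<phi> i' a'" "factorises C F (f \<cdot> i') k' e'" "active_retraction C F r' k'"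
      "\<psi>' = k' \<cdot> r'"
    unfolding fs_pushes_def by metis
  obtain h where h: "iso C h" "h \<in> hom C (Cod C a) (Cod C a')" "i = i' \<cdot> h"
    using factorisation_unique[OF 1(1) 2(1)] by blast
  have fa: "a \<in> Act F" "i \<in> Inr F" "a' \<in> Act F" "i' \<in> Inr F" "k' \<in> Inr F" "e' \<in> Act F" "k \<in> Inr F"
    "Cod C a = Dom C i" "Cod C a' = Dom C i'" "Cod C e' = Dom C k'" "\<phi> = i' \<cdot> a'"
    "f \<cdot> i' = k' \<cdot> e'"
    using 1 2 by (auto simp: factorises_def)
  have hM: "h \<in> Mor C" "Dom C h = Dom C i" "Cod C h = Dom C i'"
    using h(2) fa by (auto simp: hom_def)
  have M: "i' \<in> Mor C" "a' \<in> Mor C" "k' \<in> Mor C" "e' \<in> Mor C" using fa Act_Mor Inr_Mor by auto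
  have ci: "Cod C i' = Dom C f"
    using comp_in_Mor[of a' i'] M fa \<phi> by (auto simp: hom_def)
  have ce: "Dom C e' = Dom C i'"
    using comp_in_Mor[of i' f] comp_in_Mor[of e' k'] M fa f ci by auto
  have "f \<cdot> i = (f \<cdot> i') \<cdot> h" using h(3) assoc_Mor[of h i' f] hM M ci f by simp
  also have "\<dots> = k' \<cdot> (e' \<cdot> h)" using assoc_Mor[of h e' k'] hM M fa ce by simp
  finally have "factorises C F (f \<cdot> i) k' (e' \<cdot> h)"
    using fa hM M ce comp_in_Mor[of h e'] Act_comp[of h e'] iso_Act[OF h(1)]
    by (auto simp: factorises_def)
  then obtain l where l: "iso C l" "l \<in> hom C (Cod C e) (Cod C (e' \<cdot> h))" "k = k' \<cdot> l"
    using factorisation_unique[OF 1(2)] by blast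
  have "Cod C l = Dom C k'"
    using l(2) comp_in_Mor[of h e'] hM M ce fa by (auto simp: hom_def)
  then show "\<psi> = \<psi>'"
    using retract_idem_iso_invariant[OF fa(5) 2(3) l(1)] 1(3,4) 2(4) l(3) fa(7) by simp
qed

end

end

theory Submission imports Defs begin

text \<open>In a moment category the moments of \<open>A\<close> are the idempotents \<open>i \<cdot> r\<close> with \<open>i\<close> inert into
  \<open>A\<close> and \<open>r\<close> its active retraction. The naturality axiom (m4) holds for active morphisms by (M2)
  and for inert ones by uniqueness in (M1), hence for all morphisms; (m2) for \<open>i \<cdot> r\<close> reduces to
  (m4) for \<open>r\<close>. Conversely, if \<open>f\<^sub>*(1)\<close> splits as \<open>i \<cdot> r\<close>, then \<open>f = i \<cdot> (r \<cdot> f)\<close> is the active/inert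
  factorisation of \<open>f\<close>. Here \<open>i\<close> is inert because \<open>\<chi> = i\<^sub>*(\<psi>)\<close> and \<open>\<phi> = i \<cdot> r\<close> satisfy
  \<open>\<phi> \<cdot> \<chi> = \<chi>\<close>, whence \<open>\<chi> \<cdot> \<phi> = \<phi>\<^sub>*(\<chi>) \<cdot> \<phi> = \<phi> \<cdot> \<chi> = \<chi>\<close> by (m2) and (m4).\<close>

section \<open>Composition, identities, retractions and split idempotents in a category\<close>

context category
begin

lemma Mor_comp [simp]: "f \<in> Mor C \<Longrightarrow> g \<in> Mor C \<Longrightarrow> Cod C f = Dom C g \<Longrightarrow> g \<cdot> f \<in> Mor C"
  and Dom_comp [simp]: "f \<in> Mor C \<Longrightarrow> g \<in> Mor C \<Longrightarrow> Cod C f = Dom C g \<Longrightarrow> Dom C (g \<cdot> f) = Dom C f"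
  and Cod_comp [simp]: "f \<in> Mor C \<Longrightarrow> g \<in> Mor C \<Longrightarrow> Cod C f = Dom C g \<Longrightarrow> Cod C (g \<cdot> f) = Cod C g"
  using comp_hom[of f "Dom C f" "Cod C f" g "Cod C g"] by (simp_all add: hom_def)

lemma Mor_ide [simp]: "A \<in> Ob C \<Longrightarrow> \<one> A \<in> Mor C"
  and Dom_ide [simp]: "A \<in> Ob C \<Longrightarrow> Dom C (\<one> A) = A"
  and Cod_ide [simp]: "A \<in> Ob C \<Longrightarrow> Cod C (\<one> A) = A"
  using ide_hom[of A] by (auto simp: hom_def)

lemma ide_comp [simp]: "f \<in> Mor C \<Longrightarrow> Cod C f = B \<Longrightarrow> \<one> B \<cdot> f = f"
  and comp_ide [simp]: "f \<in> Mor C \<Longrightarrow> Dom C f = A \<Longrightarrow> f \<cdot> \<one> A = f"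
  using comp_ide_left[of f] comp_ide_right[of f] by (auto simp: hom_def)

lemma comp_assoc_Mor:
  "f \<in> Mor C \<Longrightarrow> g \<in> Mor C \<Longrightarrow> h \<in> Mor C \<Longrightarrow> Cod C f = Dom C g \<Longrightarrow> Cod C g = Dom C h \<Longrightarrow>
    (h \<cdot> g) \<cdot> f = h \<cdot> (g \<cdot> f)"
  using comp_assoc[of f "Dom C f" "Cod C f" g "Cod C g" h "Cod C h"] by (simp add: hom_def)

lemma Dom_Ob [simp]: "f \<in> Mor C \<Longrightarrow> Dom C f \<in> Ob C"
  and Cod_Ob [simp]: "f \<in> Mor C \<Longrightarrow> Cod C f \<in> Ob C"
  by (simp_all add: dom_ob cod_ob)

lemma iso_ide: "A \<in> Ob C \<Longrightarrow> iso C (\<one> A)"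
  by (auto simp: iso_def hom_def intro!: bexI[of _ "\<one> A"])

lemma retractionD:
  assumes "retraction C r i"
  shows "i \<in> Mor C" "r \<in> Mor C" "Dom C r = Cod C i" "Cod C r = Dom C i" "r \<cdot> i = \<one> (Dom C i)"
  using assms by (auto simp: retraction_def hom_def)

lemma retraction_cancel:
  assumes "retraction C r i" "f \<in> Mor C" "Cod C f = Dom C i"
  shows "r \<cdot> (i \<cdot> f) = f"
  using retractionD[OF assms(1)] assms(2,3) by (simp flip: comp_assoc_Mor)

lemma retraction_comp:
  assumes r: "retraction C r i" and s: "retraction C s j" and "Cod C i = Dom C j"
  shows "retraction C (r \<cdot> s) (j \<cdot> i)"
  using retractionD[OF r] retractionD[OF s] assms(3)
  by (simp add: retraction_def hom_def comp_assoc_Mor retraction_cancel[OF s])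

lemma retraction_cod_eq:
  assumes r: "retraction C r i" and s: "retraction C s j" and e: "i \<cdot> r = j \<cdot> s"
  shows "Cod C i = Cod C j"
  using Cod_comp[of r i] Cod_comp[of s j] retractionD[OF r] retractionD[OF s] e by simp

text \<open>Two splittings of one idempotent differ by a canonical isomorphism, with inverse
  \<open>r \<cdot> j\<close>. This supplies the comparison isomorphism between two factorisations,
  and later shows that the active part of a morphism with the inertness property is
  invertible.\<close>

lemma iso_between_splittings:
  assumes r: "retraction C r i" and s: "retraction C s j" and e: "i \<cdot> r = j \<cdot> s"
  shows "iso C (s \<cdot> i)" "s \<cdot> i \<in> hom C (Dom C i) (Dom C j)" "j \<cdot> (s \<cdot> i) = i"
proof -
  note R = retractionD[OF r] and S = retractionD[OF s] and c = retraction_cod_eq[OF r s e]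
  show "s \<cdot> i \<in> hom C (Dom C i) (Dom C j)" using R S c by (simp add: hom_def)
  have "(j \<cdot> s) \<cdot> i = i" using R by (simp add: comp_assoc_Mor flip: e)
  then show 1: "j \<cdot> (s \<cdot> i) = i" using R S c by (simp add: comp_assoc_Mor)
  have "(i \<cdot> r) \<cdot> j = j" using S by (simp add: comp_assoc_Mor e)
  then have 2: "i \<cdot> (r \<cdot> j) = j" using R S c by (simp add: comp_assoc_Mor)
  have "r \<cdot> j \<in> hom C (Dom C j) (Dom C i)" using R S c by (simp add: hom_def)
  moreover have "(r \<cdot> j) \<cdot> (s \<cdot> i) = \<one> (Dom C i)" "(s \<cdot> i) \<cdot> (r \<cdot> j) = \<one> (Dom C j)"
    using R S c 1 2 by (simp_all add: comp_assoc_Mor)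
  ultimately show "iso C (s \<cdot> i)" using R S c by (auto simp: iso_def)
qed

end

section \<open>From moment categories to moment structures\<close>

context moment_category
begin

section \<open>Factorisations and active retractions in a moment category\<close>

declare Act_Mor [simp] Inr_Mor [simp]

lemma iso_Inr: "iso C f \<Longrightarrow> f \<in> Inr F"
  and Inr_comp: "f \<in> Inr F \<Longrightarrow> g \<in> Inr F \<Longrightarrow> Cod C f = Dom C g \<Longrightarrow> g \<cdot> f \<in> Inr F"
  using inert_closed by (auto simp: closed_class_def)

lemma ide_Act: "A \<in> Ob C \<Longrightarrow> \<one> A \<in> Act F"
  and ide_Inr: "A \<in> Ob C \<Longrightarrow> \<one> A \<in> Inr F"
  by (simp_all add: iso_ide iso_Act iso_Inr)

lemma factorisesD:
  assumes "factorises C F f k e"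
  shows "k \<in> Inr F" "e \<in> Act F" "Cod C e = Dom C k" "f = k \<cdot> e" "Dom C e = Dom C f"
    "Cod C k = Cod C f"
  using assms by (auto simp: factorises_def)

lemma factorises_comp: "k \<in> Inr F \<Longrightarrow> e \<in> Act F \<Longrightarrow> Cod C e = Dom C k \<Longrightarrow> factorises C F (k \<cdot> e) k e"
  by (simp add: factorises_def)

lemma factorises_act: "f \<in> Act F \<Longrightarrow> factorises C F f (\<one> (Cod C f)) f"
  by (simp add: factorises_def ide_Inr)

lemma factorises_inr: "f \<in> Inr F \<Longrightarrow> factorises C F f f (\<one> (Dom C f))"
  by (simp add: factorises_def ide_Act)

lemma active_retractionD:
  assumes "active_retraction C F r i"
  shows "retraction C r i" "r \<in> Act F" "i \<in> Mor C" "r \<in> Mor C" "Dom C r = Cod C i"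
    "Cod C r = Dom C i" "r \<cdot> i = \<one> (Dom C i)"
  using assms retractionD by (auto simp: active_retraction_def)

lemma active_retraction_comp:
  assumes r: "active_retraction C F r i" and s: "active_retraction C F s j"
    and "Cod C i = Dom C j"
  shows "active_retraction C F (r \<cdot> s) (j \<cdot> i)"
  using active_retractionD[OF r] active_retractionD[OF s] assms(3)
  by (simp add: active_retraction_def retraction_comp Act_comp)

lemma active_retraction_ide: "A \<in> Ob C \<Longrightarrow> active_retraction C F (\<one> A) (\<one> A)"
  by (simp add: active_retraction_def retraction_def hom_def ide_Act)

lemma factorisation_with_retraction:
  assumes "f \<in> Mor C"
  obtains k e s where "factorises C F f k e" "active_retraction C F s k"
  using factorisation_exists[OF assms] M1 factorisesD(1) by metis

section \<open>Moments as idempotents split by an inert morphism\<close>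

text \<open>The condition on the factorisation of a moment says that its active part is a retraction
  of its inert part, hence the active retraction of (M1). A moment is thereby determined by its
  inert part.\<close>

lemma fs_moments_iff:
  "\<phi> \<in> fs_moments C F A \<longleftrightarrow>
    (\<exists>i r. i \<in> Inr F \<and> Cod C i = A \<and> active_retraction C F r i \<and> \<phi> = i \<cdot> r)"
proof
  assume "\<phi> \<in> fs_moments C F A"
  then obtain i r where *: "\<phi> \<in> hom C A A" "factorises C F \<phi> i r" "r \<cdot> i = \<one> (Dom C i)"
    by (auto simp: fs_moments_def)
  then show "\<exists>i r. i \<in> Inr F \<and> Cod C i = A \<and> active_retraction C F r i \<and> \<phi> = i \<cdot> r"
    using factorisesD(1-4)[OF *(2)]
    by (intro exI[of _ i] exI[of _ r]) (auto simp: active_retraction_def retraction_def hom_def)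
next
  assume "\<exists>i r. i \<in> Inr F \<and> Cod C i = A \<and> active_retraction C F r i \<and> \<phi> = i \<cdot> r"
  then obtain i r where *: "i \<in> Inr F" "Cod C i = A" "active_retraction C F r i" "\<phi> = i \<cdot> r"
    by blast
  then have "factorises C F \<phi> i r" "\<phi> \<in> hom C A A" "A \<in> Ob C"
    using active_retractionD[OF *(3)] factorises_comp[of i r] Cod_Ob[of i] by (auto simp: hom_def)
  then show "\<phi> \<in> fs_moments C F A"
    using active_retractionD(7)[OF *(3)] unfolding fs_moments_def by blast
qed

lemma fs_momentsE:
  assumes "\<phi> \<in> fs_moments C F A"
  obtains i r where "i \<in> Inr F" "Cod C i = A" "active_retraction C F r i" "\<phi> = i \<cdot> r"
  using assms by (auto simp: fs_moments_iff)

lemma fs_momentsI: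
  "i \<in> Inr F \<Longrightarrow> active_retraction C F r i \<Longrightarrow> i \<cdot> r \<in> fs_moments C F (Cod C i)"
  by (auto simp: fs_moments_iff)

lemma fs_moments_hom: "fs_moments C F A \<subseteq> hom C A A"
  by (auto simp: fs_moments_def)

lemma ide_fs_moments: "A \<in> Ob C \<Longrightarrow> \<one> A \<in> fs_moments C F A"
  using fs_momentsI[of "\<one> A" "\<one> A"] by (simp add: ide_Inr active_retraction_ide)

section \<open>The pushforward along composites and inert morphisms\<close>

text \<open>The relation \<open>fs_pushes\<close> has exactly one value, so whatever factorisation
  and retraction are at hand compute it. All later evaluations of \<open>fs_push\<close> go through
  this rule.\<close>

lemma fs_push_eq:
  assumes f: "f \<in> Mor C" and i: "i \<in> Inr F" "Cod C i = Dom C f" and r: "active_retraction C F r i"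
    and k: "factorises C F (f \<cdot> i) k e" and s: "active_retraction C F s k"
  shows "fs_push C F f (i \<cdot> r) = k \<cdot> s"
proof -
  have "i \<cdot> r \<in> hom C (Dom C f) (Dom C f)"
    using active_retractionD[OF r] i by (simp add: hom_def)
  from fs_pushes_unique[OF f this] have "\<exists>!\<psi>. fs_pushes C F f (i \<cdot> r) \<psi>" .
  moreover have "factorises C F (i \<cdot> r) i r"
    using active_retractionD[OF r] i by (simp add: factorises_comp)
  then have "fs_pushes C F f (i \<cdot> r) (k \<cdot> s)" using k s unfolding fs_pushes_def by blast
  ultimately show ?thesis unfolding fs_push_def by (rule the1_equality)
qed

text \<open>The identity moment has the identity as inert part, so what is factorised is
  \<open>f\<close> itself. The value records the inert part of \<open>f\<close>, which is how both
  classes are read off the pushforward.\<close>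

lemma fs_push_ide:
  assumes f: "factorises C F f k e" and s: "active_retraction C F s k"
  shows "fs_push C F f (\<one> (Dom C f)) = k \<cdot> s"
proof -
  have "f \<in> Mor C" using factorisesD(1-4)[OF f] by simp
  then show ?thesis
    using fs_push_eq[of f "\<one> (Dom C f)" "\<one> (Dom C f)" k e s] f s
    by (simp add: ide_Inr active_retraction_ide)
qed

lemma fs_push_moment:
  assumes f: "f \<in> Mor C" and \<phi>: "\<phi> \<in> fs_moments C F (Dom C f)"
  shows "fs_push C F f \<phi> \<in> fs_moments C F (Cod C f)"
proof -
  obtain i r where i: "i \<in> Inr F" "Cod C i = Dom C f" "active_retraction C F r i" "\<phi> = i \<cdot> r"
    using \<phi> by (rule fs_momentsE)
  then obtain k e s where ks: "factorises C F (f \<cdot> i) k e" "active_retraction C F s k"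
    using factorisation_with_retraction[of "f \<cdot> i"] f by auto
  have "fs_push C F f \<phi> = k \<cdot> s" using fs_push_eq[OF f i(1,2,3) ks] i(4) by simp
  moreover have "Cod C k = Cod C f" using factorisesD(6)[OF ks(1)] f i by simp
  ultimately show ?thesis using fs_momentsI[OF factorisesD(1)[OF ks(1)] ks(2)] by simp
qed

text \<open>If \<open>f \<cdot> i = k \<cdot> e\<close> and
  \<open>g \<cdot> k = k' \<cdot> e'\<close>, then
  \<open>g \<cdot> f \<cdot> i = k' \<cdot> (e' \<cdot> e)\<close> with \<open>e' \<cdot> e\<close>
  active. Pushing in one step or in two therefore ends at the same inert morphism
  \<open>k'\<close>.\<close>

lemma fs_push_comp:
  assumes f: "f \<in> Mor C" and g: "g \<in> Mor C" "Dom C g = Cod C f"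
    and \<phi>: "\<phi> \<in> fs_moments C F (Dom C f)"
  shows "fs_push C F (g \<cdot> f) \<phi> = fs_push C F g (fs_push C F f \<phi>)"
proof -
  obtain i r where i: "i \<in> Inr F" "Cod C i = Dom C f" "active_retraction C F r i" "\<phi> = i \<cdot> r"
    using \<phi> by (rule fs_momentsE)
  then obtain k e s where ks: "factorises C F (f \<cdot> i) k e" "active_retraction C F s k"
    using factorisation_with_retraction[of "f \<cdot> i"] f by auto
  note K = factorisesD[OF ks(1)]
  have ck: "Cod C k = Dom C g" using K(6) f g i by simp
  then obtain k' e' s' where ks': "factorises C F (g \<cdot> k) k' e'" "active_retraction C F s' k'"
    using factorisation_with_retraction[of "g \<cdot> k"] g K(1) by auto
  note K' = factorisesD[OF ks'(1)]
  have de': "Dom C e' = Dom C k" using K'(5) K(1) g ck by simp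
  have "(g \<cdot> f) \<cdot> i = g \<cdot> (k \<cdot> e)" using f g i by (simp add: comp_assoc_Mor K(4))
  also have "\<dots> = (g \<cdot> k) \<cdot> e" using f g ck K(1-3) by (simp add: comp_assoc_Mor)
  also have "\<dots> = (k' \<cdot> e') \<cdot> e" by (simp only: K'(4))
  also have "\<dots> = k' \<cdot> (e' \<cdot> e)" using K(1-3) K'(1-3) de' by (simp add: comp_assoc_Mor)
  finally have "factorises C F ((g \<cdot> f) \<cdot> i) k' (e' \<cdot> e)"
    using factorises_comp[of k' "e' \<cdot> e"] K(1-3) K'(1-3) de' by (simp add: Act_comp)
  then have "fs_push C F (g \<cdot> f) \<phi> = k' \<cdot> s'"
    using fs_push_eq[of "g \<cdot> f" i r] ks'(2) i f g by simp
  moreover have "fs_push C F f \<phi> = k \<cdot> s" using fs_push_eq[OF f i(1,2,3) ks] i(4) by simp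
  moreover have "fs_push C F g (k \<cdot> s) = k' \<cdot> s'" using fs_push_eq[OF g(1) K(1) ck ks(2) ks'] .
  ultimately show ?thesis by simp
qed

text \<open>Since \<open>f \<cdot> i\<close> is again inert, its factorisation is trivial, and its
  active retraction is the composite \<open>r \<cdot> s\<close>.\<close>

lemma fs_push_inr:
  assumes f: "f \<in> Inr F" and s: "active_retraction C F s f"
    and \<phi>: "\<phi> \<in> fs_moments C F (Dom C f)"
  shows "fs_push C F f \<phi> = f \<cdot> \<phi> \<cdot> s"
proof -
  obtain i r where i: "i \<in> Inr F" "Cod C i = Dom C f" "active_retraction C F r i" "\<phi> = i \<cdot> r"
    using \<phi> by (rule fs_momentsE)
  have "factorises C F (f \<cdot> i) (f \<cdot> i) (\<one> (Dom C (f \<cdot> i)))"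
    using factorises_inr[OF Inr_comp[OF i(1) f i(2)]] f i by simp
  moreover have "active_retraction C F (r \<cdot> s) (f \<cdot> i)" using active_retraction_comp i s by simp
  ultimately have "fs_push C F f \<phi> = (f \<cdot> i) \<cdot> (r \<cdot> s)" using fs_push_eq f i by simp
  then show ?thesis
    using f i active_retractionD[OF s] active_retractionD[OF i(3)] by (simp add: comp_assoc_Mor)
qed

section \<open>Axioms (m4) and (m2) for the pushforward\<close>

lemma fs_push_natural_inr:
  assumes f: "f \<in> Inr F" and \<phi>: "\<phi> \<in> fs_moments C F (Dom C f)"
  shows "f \<cdot> \<phi> = fs_push C F f \<phi> \<cdot> f"
proof -
  obtain s where s: "active_retraction C F s f" using M1[OF f] by blast
  have "\<phi> \<in> hom C (Dom C f) (Dom C f)" using \<phi> fs_moments_hom by blast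
  then show ?thesis
    using fs_push_inr[OF f s \<phi>] active_retractionD[OF s] by (simp add: comp_assoc_Mor hom_def)
qed

text \<open>Here (M2) enters: the active morphism \<open>s \<cdot> f\<close> restricts along
  \<open>i\<close> to the active morphism \<open>e\<close>, so it equals
  \<open>e \<cdot> r\<close>.\<close>

lemma fs_push_natural_act:
  assumes f: "f \<in> Act F" and \<phi>: "\<phi> \<in> fs_moments C F (Dom C f)"
  shows "f \<cdot> \<phi> = fs_push C F f \<phi> \<cdot> f"
proof -
  obtain i r where i: "i \<in> Inr F" "Cod C i = Dom C f" "active_retraction C F r i" "\<phi> = i \<cdot> r"
    using \<phi> by (rule fs_momentsE)
  then obtain k e s where ks: "factorises C F (f \<cdot> i) k e" "active_retraction C F s k"
    using factorisation_with_retraction[of "f \<cdot> i"] f by auto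
  note K = factorisesD[OF ks(1)] and R = active_retractionD[OF i(3)]
    and S = active_retractionD[OF ks(2)]
  have ck: "Cod C k = Cod C f" and de: "Dom C e = Dom C i" using K(5,6) f i by simp_all
  have "(s \<cdot> f) \<cdot> i = s \<cdot> (k \<cdot> e)" using f i S ck by (simp add: comp_assoc_Mor K(4))
  also have "\<dots> = e" using retraction_cancel[OF S(1)] K(1-3) by simp
  finally have "s \<cdot> f = e \<cdot> r"
    using M2[OF i(1) _ K(2) _ _ i(3), of "s \<cdot> f"] f i S ck by (simp add: Act_comp)
  \<comment> \<open>Composing with \<open>k\<close> on the left turns \<open>s \<cdot> f\<close>
    into the pushed moment after \<open>f\<close>, and \<open>e \<cdot> r\<close> into
    \<open>f \<cdot> i \<cdot> r\<close>.\<close>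
  then have "k \<cdot> (s \<cdot> f) = (k \<cdot> e) \<cdot> r"
    using K(1-3) R S ck de by (simp add: comp_assoc_Mor)
  also have "\<dots> = (f \<cdot> i) \<cdot> r" by (simp only: K(4))
  finally have "(k \<cdot> s) \<cdot> f = f \<cdot> \<phi>" using f i R S ck by (simp add: comp_assoc_Mor)
  then show ?thesis using fs_push_eq[of f i r k e s] f i ks by simp
qed

text \<open>Naturality squares paste: the square of the active part \<open>e\<close> is followed by
  that of the inert part \<open>k\<close>, the moment in the middle being
  \<open>?\<psi>\<close>.\<close>

lemma fs_push_natural:
  assumes f: "f \<in> Mor C" and \<phi>: "\<phi> \<in> fs_moments C F (Dom C f)"
  shows "f \<cdot> \<phi> = fs_push C F f \<phi> \<cdot> f"
proof -
  obtain k e where ke: "factorises C F f k e" using factorisation_exists[OF f] by blast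
  note K = factorisesD[OF ke]
  let ?\<psi> = "fs_push C F e \<phi>"
  have \<psi>: "?\<psi> \<in> fs_moments C F (Dom C k)" using fs_push_moment[of e \<phi>] K(1-4) \<phi> by simp
  have \<chi>: "fs_push C F f \<phi> = fs_push C F k ?\<psi>" using fs_push_comp[of e k \<phi>] K(1-4) \<phi> by simp
  have hom: "\<phi> \<in> hom C (Dom C f) (Dom C f)" "?\<psi> \<in> hom C (Dom C k) (Dom C k)"
    "fs_push C F k ?\<psi> \<in> hom C (Cod C k) (Cod C k)"
    using \<phi> \<psi> fs_push_moment[of k ?\<psi>] K(1) fs_moments_hom by auto
  have "(k \<cdot> e) \<cdot> \<phi> = k \<cdot> (?\<psi> \<cdot> e)"
    using K(1-3,5) hom fs_push_natural_act[of e \<phi>] \<phi> by (simp add: comp_assoc_Mor hom_def)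
  also have "\<dots> = (k \<cdot> ?\<psi>) \<cdot> e" using K(1-3) hom by (simp add: comp_assoc_Mor hom_def)
  also have "\<dots> = fs_push C F k ?\<psi> \<cdot> (k \<cdot> e)"
    using fs_push_natural_inr[OF K(1) \<psi>] K(1-3) hom by (simp add: comp_assoc_Mor hom_def)
  finally show ?thesis using K(4) \<chi> by simp
qed

text \<open>Pushing along \<open>\<phi> = i \<cdot> r\<close> goes first along \<open>r\<close> and
  then along \<open>i\<close>. The latter is conjugation by \<open>i\<close> and \<open>r\<close>,
  and naturality for \<open>r\<close> moves \<open>r\<close> to the left of
  \<open>\<psi>\<close>.\<close>

lemma fs_push_by_moment:
  assumes \<phi>: "\<phi> \<in> fs_moments C F A" and \<psi>: "\<psi> \<in> fs_moments C F A"
  shows "fs_push C F \<phi> \<psi> = \<phi> \<cdot> \<psi>"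
proof -
  obtain i r where i: "i \<in> Inr F" "Cod C i = A" "active_retraction C F r i" "\<phi> = i \<cdot> r"
    using \<phi> by (rule fs_momentsE)
  note R = active_retractionD[OF i(3)]
  have \<chi>: "fs_push C F r \<psi> \<in> fs_moments C F (Dom C i)" using fs_push_moment[of r \<psi>] R i \<psi> by simp
  have hom: "\<psi> \<in> hom C A A" "fs_push C F r \<psi> \<in> hom C (Dom C i) (Dom C i)"
    using \<psi> \<chi> fs_moments_hom by auto
  have "fs_push C F \<phi> \<psi> = fs_push C F i (fs_push C F r \<psi>)"
    using fs_push_comp[of r i \<psi>] R i \<psi> by simp
  also have "\<dots> = i \<cdot> (fs_push C F r \<psi> \<cdot> r)"
    using fs_push_inr[OF i(1,3) \<chi>] i R hom by (simp add: comp_assoc_Mor hom_def)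
  also have "\<dots> = i \<cdot> (r \<cdot> \<psi>)" using fs_push_natural[of r \<psi>] R i \<psi> by simp
  also have "\<dots> = \<phi> \<cdot> \<psi>" using i R hom by (simp add: comp_assoc_Mor hom_def)
  finally show ?thesis .
qed

lemma fs_moments_split:
  assumes "\<phi> \<in> fs_moments C F A"
  shows "splits C A \<phi>"
proof -
  obtain i r where i: "i \<in> Inr F" "Cod C i = A" "active_retraction C F r i" "\<phi> = i \<cdot> r"
    using assms by (rule fs_momentsE)
  then have "Dom C i \<in> Ob C" "i \<in> hom C (Dom C i) A" "r \<in> hom C A (Dom C i)"
    using active_retractionD[OF i(3)] by (simp_all add: hom_def)
  then show ?thesis using active_retractionD(7)[OF i(3)] i(4) unfolding splits_def by blast
qed

lemma moment_structure_of_simps: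
  "moments (moment_structure_of C F) = fs_moments C F"
  "f \<in> Mor C \<Longrightarrow> \<phi> \<in> fs_moments C F (Dom C f) \<Longrightarrow>
    push (moment_structure_of C F) f \<phi> = fs_push C F f \<phi>"
  by (simp_all add: moment_structure_of_def)

lemma split_moment_structure_of: "split_moment_structure C (moment_structure_of C F)"
proof (unfold_locales, goal_cases)
  \<comment> \<open>Cases 1 to 4 are the typing and extensionality conditions, 5 to 8 are (m1) to
    (m4), and 9 is the splitting of moments.\<close>
  case 1 show ?case by (simp add: moment_structure_of_simps fs_moments_hom)
next
  case (2 A) then show ?case by (auto simp: moment_structure_of_simps fs_moments_def)
next
  case (3 f A B)
  then have "f \<in> Mor C" "Dom C f = A" "Cod C f = B" by (auto simp: hom_def)
  then show ?case using fs_push_moment[of f] by (auto simp: moment_structure_of_def)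
next
  case 4 show ?case by (simp add: moment_structure_of_def)
next
  case (5 A) then show ?case by (simp add: moment_structure_of_simps ide_fs_moments)
next
  case (6 A \<phi> \<psi>)
  then have "\<phi> \<in> hom C A A" using fs_moments_hom by (auto simp: moment_structure_of_simps)
  with 6 show ?case
    using fs_push_by_moment[of \<phi> A \<psi>] by (simp add: moment_structure_of_simps hom_def)
next
  case (7 f A B g D \<phi>)
  then have "f \<in> Mor C" "Dom C f = A" "Cod C f = B" "g \<in> Mor C" "Dom C g = B"
    "\<phi> \<in> fs_moments C F A"
    by (auto simp: hom_def moment_structure_of_simps)
  then show ?case
    using fs_push_comp[of f g \<phi>] fs_push_moment[of f \<phi>] by (simp add: moment_structure_of_simps)
next
  case (8 f A B \<phi>)
  then have "f \<in> Mor C" "Dom C f = A" "\<phi> \<in> fs_moments C F A"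
    by (auto simp: hom_def moment_structure_of_simps)
  then show ?case using fs_push_natural[of f \<phi>] by (simp add: moment_structure_of_simps)
next
  case (9 A \<phi>) then show ?case by (simp add: moment_structure_of_simps fs_moments_split)
qed

section \<open>Recovering the factorisation system\<close>

text \<open>With \<open>f = k \<cdot> e\<close>, the value \<open>k \<cdot> s\<close> of the
  pushforward at the identity is an identity exactly when the inert part \<open>k\<close> is
  invertible, that is, when \<open>f\<close> is active.\<close>

lemma ms_active_moment_structure_of: "ms_active C (moment_structure_of C F) = Act F"
proof -
  have "fs_push C F f (\<one> (Dom C f)) = \<one> (Cod C f) \<longleftrightarrow> f \<in> Act F" if f: "f \<in> Mor C" for f
  proof
    assume 1: "fs_push C F f (\<one> (Dom C f)) = \<one> (Cod C f)"
    obtain k e s where ks: "factorises C F f k e" "active_retraction C F s k"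
      using factorisation_with_retraction[OF f] .
    note K = factorisesD[OF ks(1)] and S = active_retractionD[OF ks(2)]
    have "k \<cdot> s = \<one> (Cod C k)" using fs_push_ide[OF ks] 1 K(6) by simp
    moreover have "s \<in> hom C (Cod C k) (Dom C k)" using S by (simp add: hom_def)
    ultimately have "iso C k" using S(3,7) unfolding iso_def by blast
    then show "f \<in> Act F" using K(1-4) Act_comp[of e k] iso_Act by simp
  next
    assume "f \<in> Act F"
    then show "fs_push C F f (\<one> (Dom C f)) = \<one> (Cod C f)"
      using fs_push_ide[OF factorises_act active_retraction_ide] f by simp
  qed
  then show ?thesis by (auto simp: ms_active_def moment_structure_of_simps ide_fs_moments)
qed

text \<open>At the identity moment the inertness condition reads
  \<open>f \<cdot> r = k \<cdot> s\<close>. So \<open>f\<close> and its inert part \<open>k\<close>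
  split the same idempotent, and the comparison \<open>s \<cdot> f\<close> between them is the
  active part \<open>e\<close>, which is therefore invertible.\<close>

lemma ms_inert_moment_structure_of: "ms_inert C (moment_structure_of C F) = Inr F"
proof -
  have *: "(\<exists>r. retraction C r f \<and> (\<forall>\<phi>\<in>fs_moments C F (Dom C f). fs_push C F f \<phi> = f \<cdot> \<phi> \<cdot> r))
      \<longleftrightarrow> f \<in> Inr F" if f: "f \<in> Mor C" for f
  proof
    assume "\<exists>r. retraction C r f \<and> (\<forall>\<phi>\<in>fs_moments C F (Dom C f). fs_push C F f \<phi> = f \<cdot> \<phi> \<cdot> r)"
    then obtain r where r: "retraction C r f" and
      1: "fs_push C F f (\<one> (Dom C f)) = f \<cdot> \<one> (Dom C f) \<cdot> r"
      using ide_fs_moments f by auto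
    obtain k e s where ks: "factorises C F f k e" "active_retraction C F s k"
      using factorisation_with_retraction[OF f] .
    note K = factorisesD[OF ks(1)] and S = active_retractionD[OF ks(2)] and R = retractionD[OF r]
    have "f \<cdot> r = k \<cdot> s" using 1 fs_push_ide[OF ks] f by simp
    then have "iso C (s \<cdot> f)" by (rule iso_between_splittings(1)[OF r S(1)])
    moreover have "s \<cdot> f = e" using retraction_cancel[OF S(1), of e] K(1-4) by simp
    ultimately show "f \<in> Inr F" using K(1-4) iso_Inr Inr_comp by simp
  next
    assume I: "f \<in> Inr F"
    then obtain s where "active_retraction C F s f" using M1 by blast
    then show "\<exists>r. retraction C r f \<and>
        (\<forall>\<phi>\<in>fs_moments C F (Dom C f). fs_push C F f \<phi> = f \<cdot> \<phi> \<cdot> r)"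
      using fs_push_inr[OF I] active_retractionD(1) by blast
  qed
  have "f \<in> ms_inert C (moment_structure_of C F) \<longleftrightarrow> f \<in> Inr F" if "f \<in> Mor C" for f
    using that *[OF that] by (simp add: ms_inert_def moment_structure_of_simps)
  then show ?thesis using Inr_Mor unfolding ms_inert_def by blast
qed

lemma factorisation_system_of_moment_structure_of:
  "factorisation_system_of C (moment_structure_of C F) = F"
  by (simp add: factorisation_system_of_def ms_active_moment_structure_of
      ms_inert_moment_structure_of)

end

section \<open>From split moment structures to moment categories\<close>

context moment_structure
begin

section \<open>The axioms of a moment structure in terms of domains and codomains\<close>

lemma moments_hom:
  assumes "\<phi> \<in> moments M A"
  shows "A \<in> Ob C" "\<phi> \<in> Mor C" "Dom C \<phi> = A" "Cod C \<phi> = A"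
  using assms moments_endo[of A] moments_outside[of A] by (auto simp: hom_def)

lemma push_moment: "f \<in> Mor C \<Longrightarrow> \<phi> \<in> moments M (Dom C f) \<Longrightarrow> push M f \<phi> \<in> moments M (Cod C f)"
  using push_fun[of f "Dom C f" "Cod C f"] by (auto simp: hom_def)

lemma push_comp:
  "f \<in> Mor C \<Longrightarrow> g \<in> Mor C \<Longrightarrow> Dom C g = Cod C f \<Longrightarrow> \<phi> \<in> moments M (Dom C f) \<Longrightarrow>
    push M (g \<cdot> f) \<phi> = push M g (push M f \<phi>)"
  using m3[of f "Dom C f" "Cod C f" g "Cod C g" \<phi>] by (simp add: hom_def)

lemma push_natural:
  "f \<in> Mor C \<Longrightarrow> \<phi> \<in> moments M (Dom C f) \<Longrightarrow> push M f \<phi> \<cdot> f = f \<cdot> \<phi>"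
  using m4[of f "Dom C f" "Cod C f" \<phi>] by (simp add: hom_def)

lemma push_by_moment: "\<phi> \<in> moments M A \<Longrightarrow> \<psi> \<in> moments M A \<Longrightarrow> push M \<phi> \<psi> = \<phi> \<cdot> \<psi>"
  using m2[of A] moments_hom(1) by blast

lemma push_ide: "\<psi> \<in> moments M A \<Longrightarrow> push M (\<one> A) \<psi> = \<psi>"
  using push_by_moment[of "\<one> A" A \<psi>] moments_hom[of \<psi> A] m1 by simp

lemma push_ide_ide: "A \<in> Ob C \<Longrightarrow> push M (\<one> A) (\<one> A) = \<one> A"
  by (simp add: push_ide m1)

section \<open>Closedness of the active and inert classes\<close>

lemma active_Mor: "f \<in> ms_active C M \<Longrightarrow> f \<in> Mor C"
  and inert_Mor: "f \<in> ms_inert C M \<Longrightarrow> f \<in> Mor C"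
  by (auto simp: ms_active_def ms_inert_def)

lemma active_push_ide: "f \<in> ms_active C M \<Longrightarrow> push M f (\<one> (Dom C f)) = \<one> (Cod C f)"
  by (simp add: ms_active_def)

lemma active_comp:
  "f \<in> ms_active C M \<Longrightarrow> g \<in> ms_active C M \<Longrightarrow> Cod C f = Dom C g \<Longrightarrow> g \<cdot> f \<in> ms_active C M"
  by (simp add: ms_active_def push_comp m1)

lemma inert_comp:
  assumes f: "f \<in> ms_inert C M" and g: "g \<in> ms_inert C M" and c: "Cod C f = Dom C g"
  shows "g \<cdot> f \<in> ms_inert C M"
proof -
  obtain r where r: "retraction C r f" "\<And>\<phi>. \<phi> \<in> moments M (Dom C f) \<Longrightarrow> push M f \<phi> = f \<cdot> \<phi> \<cdot> r"
    using f by (auto simp: ms_inert_def)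
  obtain s where s: "retraction C s g" "\<And>\<phi>. \<phi> \<in> moments M (Dom C g) \<Longrightarrow> push M g \<phi> = g \<cdot> \<phi> \<cdot> s"
    using g by (auto simp: ms_inert_def)
  note R = retractionD[OF r(1)] and S = retractionD[OF s(1)]
  have "push M (g \<cdot> f) \<phi> = (g \<cdot> f) \<cdot> \<phi> \<cdot> (r \<cdot> s)" if \<phi>: "\<phi> \<in> moments M (Dom C f)" for \<phi>
  proof -
    have "push M (g \<cdot> f) \<phi> = g \<cdot> (f \<cdot> \<phi> \<cdot> r) \<cdot> s"
      using push_comp[of f g \<phi>] push_moment[of f \<phi>] r(2)[OF \<phi>] s(2) \<phi> R S c by simp
    then show ?thesis using R S c moments_hom[OF \<phi>] by (simp add: comp_assoc_Mor)
  qed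
  then show ?thesis
    using retraction_comp[OF r(1) s(1) c] R S c by (auto simp: ms_inert_def)
qed

text \<open>Cancelling the inverse \<open>g\<close> in (m4) forces the pushforward along
  \<open>f\<close> to be conjugation by \<open>f\<close>. This is the inertness formula, and at the
  identity it gives activity.\<close>

lemma iso_active_inert:
  assumes "iso C f"
  shows "f \<in> ms_active C M" "f \<in> ms_inert C M"
proof -
  obtain g where f: "f \<in> Mor C" and g: "g \<in> Mor C" "Dom C g = Cod C f" "Cod C g = Dom C f"
    "g \<cdot> f = \<one> (Dom C f)" "f \<cdot> g = \<one> (Cod C f)"
    using assms by (auto simp: iso_def hom_def)
  have eq: "push M f \<phi> = f \<cdot> \<phi> \<cdot> g" if \<phi>: "\<phi> \<in> moments M (Dom C f)" for \<phi>
  proof -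
    note \<psi> = moments_hom[OF push_moment[OF f \<phi>]]
    have "f \<cdot> \<phi> \<cdot> g = (push M f \<phi> \<cdot> f) \<cdot> g" using push_natural[OF f \<phi>] by simp
    also have "\<dots> = push M f \<phi>" using f g \<psi> by (simp add: comp_assoc_Mor)
    finally show ?thesis by simp
  qed
  show "f \<in> ms_active C M" using eq[OF m1] f g by (simp add: ms_active_def)
  show "f \<in> ms_inert C M"
    using eq f g by (auto simp: ms_inert_def retraction_def hom_def intro!: exI[of _ g])
qed

lemma closed_class_active: "closed_class C (ms_active C M)"
  using active_Mor active_comp iso_active_inert by (auto simp: closed_class_def)

lemma closed_class_inert: "closed_class C (ms_inert C M)"
  using inert_Mor inert_comp iso_active_inert by (auto simp: closed_class_def)

section \<open>Splittings of moments\<close>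

text \<open>Put \<open>\<phi> = i \<cdot> r\<close>. By (m4),
  \<open>r\<^sub>*(\<phi>) \<cdot> r = r \<cdot> \<phi> = r\<close>, and \<open>r\<close> has the
  section \<open>i\<close>, so \<open>r\<^sub>*(\<phi>)\<close> is an identity. It remains to
  replace \<open>\<phi>\<close> by the identity moment.\<close>

lemma retraction_active:
  assumes r: "retraction C r i" and m: "i \<cdot> r \<in> moments M (Cod C i)"
  shows "r \<in> ms_active C M"
proof -
  note R = retractionD[OF r]
  let ?\<phi> = "i \<cdot> r"
  have "push M r ?\<phi> \<cdot> r = r \<cdot> ?\<phi>" using push_natural[of r ?\<phi>] R m by simp
  also have "\<dots> = r" using retraction_cancel[OF r] R by simp
  finally have "(push M r ?\<phi> \<cdot> r) \<cdot> i = r \<cdot> i" by simp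
  moreover have "push M r ?\<phi> \<in> moments M (Dom C i)" using push_moment[of r ?\<phi>] R m by simp
  ultimately have 1: "push M r ?\<phi> = \<one> (Dom C i)"
    using moments_hom[of "push M r ?\<phi>" "Dom C i"] R by (simp add: comp_assoc_Mor)
  \<comment> \<open>By (m2) a moment is its own pushforward of the identity, so (m3) and
    \<open>r \<cdot> \<phi> = r\<close> give
    \<open>r\<^sub>*(\<phi>) = r\<^sub>*(1)\<close>.\<close>
  have "?\<phi> = push M ?\<phi> (\<one> (Cod C i))" using push_by_moment[OF m m1] R by (simp add: comp_assoc_Mor)
  then have "push M r ?\<phi> = push M (r \<cdot> ?\<phi>) (\<one> (Cod C i))"
    using push_comp[of ?\<phi> r "\<one> (Cod C i)"] R m1 by simp
  also have "\<dots> = push M r (\<one> (Cod C i))" using retraction_cancel[OF r] R by simp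
  finally show ?thesis using 1 R by (simp add: ms_active_def)
qed

text \<open>Together (m2) and (m4) yield
  \<open>\<phi> \<cdot> \<chi> \<cdot> \<phi> = \<phi> \<cdot> \<chi>\<close>, the identity of a
  left regular band.\<close>

lemma moment_absorb:
  assumes \<phi>: "\<phi> \<in> moments M A" and \<chi>: "\<chi> \<in> moments M A" and e: "\<phi> \<cdot> \<chi> = \<chi>"
  shows "\<chi> \<cdot> \<phi> = \<chi>"
proof -
  note P = moments_hom[OF \<phi>] and X = moments_hom[OF \<chi>]
  have "push M \<phi> \<chi> \<cdot> \<phi> = \<phi> \<cdot> \<chi>" using push_natural[of \<phi> \<chi>] P \<chi> by simp
  then show ?thesis using push_by_moment[OF \<phi> \<chi>] e by simp
qed

text \<open>From \<open>?\<phi> \<cdot> i = i\<close> it follows that \<open>?\<chi>\<close> is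
  fixed by \<open>?\<phi>\<close> on the left, hence by absorption on the right. Then
  \<open>?\<chi> = ?\<chi> \<cdot> i \<cdot> r\<close>, and (m4) for \<open>i\<close>
  finishes.\<close>

lemma split_moment_push:
  assumes r: "retraction C r i" and m: "i \<cdot> r \<in> moments M (Cod C i)"
    and \<psi>: "\<psi> \<in> moments M (Dom C i)"
  shows "push M i \<psi> = i \<cdot> \<psi> \<cdot> r"
proof -
  note R = retractionD[OF r]
  let ?\<phi> = "i \<cdot> r" and ?\<chi> = "push M i \<psi>"
  have \<chi>: "?\<chi> \<in> moments M (Cod C i)" using push_moment R \<psi> by simp
  have "?\<phi> \<cdot> i = i" using R by (simp add: comp_assoc_Mor)
  then have "push M ?\<phi> ?\<chi> = ?\<chi>" using push_comp[of i ?\<phi> \<psi>] R \<psi> by simp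
  then have "?\<phi> \<cdot> ?\<chi> = ?\<chi>" using push_by_moment[OF m \<chi>] by simp
  then have "?\<chi> = ?\<chi> \<cdot> ?\<phi>" using moment_absorb[OF m \<chi>] by simp
  also have "\<dots> = (?\<chi> \<cdot> i) \<cdot> r" using R moments_hom[OF \<chi>] by (simp add: comp_assoc_Mor)
  also have "\<dots> = i \<cdot> \<psi> \<cdot> r" using push_natural R \<psi> by simp
  finally show ?thesis .
qed

text \<open>The value at the identity is always a moment. If \<open>i\<close> and \<open>r\<close>
  split it, the formula for splittings of moments extends from the identity to all moments.\<close>

lemma inert_iff: "i \<in> ms_inert C M \<longleftrightarrow> (\<exists>r. retraction C r i \<and> i \<cdot> r = push M i (\<one> (Dom C i)))"
proof
  assume "i \<in> ms_inert C M"
  then obtain r where r: "retraction C r i"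
    "push M i (\<one> (Dom C i)) = i \<cdot> \<one> (Dom C i) \<cdot> r"
    using m1 by (auto simp: ms_inert_def)
  then show "\<exists>r. retraction C r i \<and> i \<cdot> r = push M i (\<one> (Dom C i))"
    using retractionD[OF r(1)] by (intro exI[of _ r]) simp
next
  assume "\<exists>r. retraction C r i \<and> i \<cdot> r = push M i (\<one> (Dom C i))"
  then obtain r where r: "retraction C r i" "i \<cdot> r = push M i (\<one> (Dom C i))" by blast
  then have "i \<cdot> r \<in> moments M (Cod C i)"
    using push_moment[of i "\<one> (Dom C i)"] m1 retractionD[OF r(1)] by simp
  then show "i \<in> ms_inert C M"
    using split_moment_push[OF r(1)] r(1) retractionD[OF r(1)] by (auto simp: ms_inert_def)
qed

lemma inert_of_split_moment:
  assumes r: "retraction C r i" and m: "i \<cdot> r \<in> moments M (Cod C i)"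
  shows "i \<in> ms_inert C M"
  using split_moment_push[OF r m m1] retractionD[OF r] r by (auto simp: inert_iff)

section \<open>Axiom (M2) and active retractions\<close>

text \<open>This is (M2). Since \<open>i \<cdot> r = i\<^sub>*(1)\<close>, pushing it along
  \<open>f\<close> gives \<open>(f \<cdot> i)\<^sub>*(1) = 1\<close>, and (m4) becomes
  \<open>f \<cdot> i \<cdot> r = f\<close>.\<close>

lemma active_comp_inert:
  assumes r: "retraction C r i" "i \<cdot> r = push M i (\<one> (Dom C i))"
    and f: "f \<in> ms_active C M" "Dom C f = Cod C i" and g: "f \<cdot> i \<in> ms_active C M"
  shows "f = (f \<cdot> i) \<cdot> r"
proof -
  note R = retractionD[OF r(1)] and fM = active_Mor[OF f(1)]
  have m: "i \<cdot> r \<in> moments M (Dom C f)"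
    using push_moment[of i "\<one> (Dom C i)"] m1 R f r by simp
  have "push M f (i \<cdot> r) = push M (f \<cdot> i) (\<one> (Dom C i))"
    using push_comp[of i f "\<one> (Dom C i)"] R f fM r m1 by simp
  also have "\<dots> = \<one> (Cod C f)" using active_push_ide[OF g] R f fM by simp
  finally have "f \<cdot> (i \<cdot> r) = f" using push_natural[OF fM m] fM by simp
  then show ?thesis using R f fM by (simp add: comp_assoc_Mor)
qed

text \<open>Any active retraction \<open>r\<close> satisfies
  \<open>r = (r \<cdot> i) \<cdot> s = s\<close> by the (M2) property, because
  \<open>r \<cdot> i\<close> is an identity and so active. It thus agrees with the retraction
  \<open>s\<close> splitting \<open>i\<^sub>*(1)\<close>.\<close>

lemma active_retraction_iff:
  assumes i: "i \<in> ms_inert C M"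
  shows "active_retraction C (factorisation_system_of C M) r i \<longleftrightarrow>
    retraction C r i \<and> i \<cdot> r = push M i (\<one> (Dom C i))" (is "?a r \<longleftrightarrow> ?b r")
proof -
  obtain s where s: "retraction C s i" "i \<cdot> s = push M i (\<one> (Dom C i))"
    using i by (auto simp: inert_iff)
  have *: "?a r" if "?b r" for r
    using retraction_active[of r i] push_moment[of i "\<one> (Dom C i)"] m1 retractionD[of r i] that
    by (auto simp: active_retraction_def factorisation_system_of_def)
  have "r = s" if "?a r"
  proof -
    have r: "retraction C r i" "r \<in> ms_active C M"
      using that by (auto simp: active_retraction_def factorisation_system_of_def)
    then have "r \<cdot> i \<in> ms_active C M"
      using retractionD[of r i] iso_active_inert iso_ide by simp
    then show "r = s"
      using active_comp_inert[OF s r(2)] retractionD[OF r(1)] retractionD[OF s(1)] by simp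
  qed
  with * s show ?thesis by blast
qed

text \<open>The idempotent belonging to the inert part depends only on the composite. This drives
  both the uniqueness of factorisations and the comparison of the two pushforwards.\<close>

lemma push_ide_factorised:
  assumes k: "k \<in> ms_inert C M" and e: "e \<in> ms_active C M" and c: "Cod C e = Dom C k"
    and s: "retraction C s k" "k \<cdot> s = push M k (\<one> (Dom C k))"
  shows "push M (k \<cdot> e) (\<one> (Dom C e)) = k \<cdot> s"
  using push_comp[of e k "\<one> (Dom C e)"] active_push_ide[OF e] active_Mor[OF e] inert_Mor[OF k]
    m1 c s(2) by simp

end

section \<open>The moment category of a split moment structure\<close>

context split_moment_structure
begin

lemma momentsE:
  assumes "\<phi> \<in> moments M A"
  obtains i r where "retraction C r i" "Cod C i = A" "\<phi> = i \<cdot> r"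
  using moments_split[OF moments_hom(1)[OF assms] assms]
  by (auto simp: splits_def retraction_def hom_def)

lemma moment_category_of: "moment_category C (factorisation_system_of C M)"
proof (unfold_locales, goal_cases)
  \<comment> \<open>Cases 1 and 2 are closedness, 3 and 4 existence and uniqueness of
    factorisations, 5 is (M1) and 6 is (M2).\<close>
  case 1 show ?case using closed_class_active by (simp add: factorisation_system_of_def)
next
  case 2 show ?case using closed_class_inert by (simp add: factorisation_system_of_def)
next
  case (3 f)
  let ?\<phi> = "push M f (\<one> (Dom C f))"
  have \<phi>: "?\<phi> \<in> moments M (Cod C f)" using push_moment 3 m1 by simp
  then obtain i r where i: "retraction C r i" "Cod C i = Cod C f" "?\<phi> = i \<cdot> r" by (rule momentsE)
  note R = retractionD[OF i(1)]
  have m: "i \<cdot> r \<in> moments M (Cod C i)" using \<phi> i by simp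
  have "push M (r \<cdot> f) (\<one> (Dom C f)) = push M r (i \<cdot> r)"
    using push_comp[of f r "\<one> (Dom C f)"] 3 R i m1 by simp
  \<comment> \<open>Rewriting \<open>i \<cdot> r\<close> as \<open>i\<^sub>*(1)\<close> lets (m3)
    collapse the double pushforward along \<open>r \<cdot> i = 1\<close>.\<close>
  also have "\<dots> = push M r (push M i (\<one> (Dom C i)))"
    using split_moment_push[OF i(1) m m1] R by simp
  also have "\<dots> = \<one> (Dom C i)"
    using push_comp[of i r "\<one> (Dom C i)"] R m1 by (simp add: push_ide_ide)
  finally have "r \<cdot> f \<in> ms_active C M" using 3 R i by (simp add: ms_active_def)
  moreover have "f = i \<cdot> (r \<cdot> f)"
    using push_natural[of f "\<one> (Dom C f)"] 3 R i m1 by (simp add: comp_assoc_Mor)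
  moreover have "i \<in> ms_inert C M" using inert_of_split_moment i(1) m .
  ultimately have "factorises C (factorisation_system_of C M) f i (r \<cdot> f)"
    using 3 R i by (simp add: factorises_def factorisation_system_of_def)
  then show ?case by blast
next
  case (4 f i a j b)
  then have ij: "i \<in> ms_inert C M" "a \<in> ms_active C M" "Cod C a = Dom C i" "f = i \<cdot> a"
    "j \<in> ms_inert C M" "b \<in> ms_active C M" "Cod C b = Dom C j" "f = j \<cdot> b"
    by (auto simp: factorises_def factorisation_system_of_def)
  obtain r where r: "retraction C r i" "i \<cdot> r = push M i (\<one> (Dom C i))"
    using ij(1) by (auto simp: inert_iff)
  obtain s where s: "retraction C s j" "j \<cdot> s = push M j (\<one> (Dom C j))"
    using ij(5) by (auto simp: inert_iff)
  note R = retractionD[OF r(1)] and S = retractionD[OF s(1)] and aM = active_Mor[OF ij(2)]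
    and bM = active_Mor[OF ij(6)]
  \<comment> \<open>Both factorisations start at the same object, so both idempotents are the
    pushforward of the same identity along \<open>f\<close>.\<close>
  have "Dom C f = Dom C a" using ij(3,4) aM R by simp
  moreover have "Dom C f = Dom C b" using ij(7,8) bM S by simp
  ultimately have e: "i \<cdot> r = j \<cdot> s"
    using push_ide_factorised[OF ij(1,2,3) r] push_ide_factorised[OF ij(5,6,7) s] ij(4,8) by simp
  note h = iso_between_splittings[OF r(1) s(1) e]
  have "(s \<cdot> i) \<cdot> a = s \<cdot> (j \<cdot> b)"
    using R S aM ij(3) retraction_cod_eq[OF r(1) s(1) e]
    by (simp add: comp_assoc_Mor flip: ij(4,8))
  also have "\<dots> = b" using retraction_cancel[OF s(1) bM ij(7)] .
  finally have hb: "(s \<cdot> i) \<cdot> a = b" .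
  show ?case
  proof (rule ex1I[of _ "s \<cdot> i"])
    show "iso C (s \<cdot> i) \<and> s \<cdot> i \<in> hom C (Cod C a) (Cod C b) \<and> i = j \<cdot> (s \<cdot> i) \<and> (s \<cdot> i) \<cdot> a = b"
      using h hb ij(3,7) by simp
  next
    \<comment> \<open>The retraction \<open>s\<close> of \<open>j\<close> cancels \<open>j\<close>
      in \<open>i = j \<cdot> h\<close>, which leaves only \<open>h = s \<cdot> i\<close>.\<close>
    fix h assume "iso C h \<and> h \<in> hom C (Cod C a) (Cod C b) \<and> i = j \<cdot> h \<and> h \<cdot> a = b"
    then show "h = s \<cdot> i" using retraction_cancel[OF s(1), of h] ij(7) by (auto simp: hom_def)
  qed
next
  case (5 i)
  then have i: "i \<in> ms_inert C M" by (simp add: factorisation_system_of_def)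
  then obtain r where r: "retraction C r i" "i \<cdot> r = push M i (\<one> (Dom C i))"
    by (auto simp: inert_iff)
  \<comment> \<open>Both retractions give the same idempotent, and applying \<open>r\<close> on the
    left cancels \<open>i\<close>.\<close>
  have "s = r" if s: "retraction C s i" "i \<cdot> s = push M i (\<one> (Dom C i))" for s
    using retraction_cancel[OF r(1), of s] retraction_cancel[OF r(1), of r] retractionD[OF s(1)]
      retractionD[OF r(1)] s(2) r(2) by simp
  with r show ?case by (auto simp: active_retraction_iff[OF i])
next
  case (6 i f g r)
  then have *: "i \<in> ms_inert C M" "f \<in> ms_active C M" "g \<in> ms_active C M"
    by (simp_all add: factorisation_system_of_def)
  then show ?case
    using active_comp_inert[of r i f] active_retraction_iff[OF *(1)] 6 by simp
qed

section \<open>Recovering the moment structure\<close>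

text \<open>An inert \<open>i\<close> with its active retraction \<open>r\<close> composes to
  \<open>i\<^sub>*(1)\<close>, which is a moment. Conversely, any splitting of a moment consists of
  an inert \<open>i\<close> and an active \<open>r\<close>.\<close>

lemma fs_moments_factorisation_system_of: "fs_moments C (factorisation_system_of C M) = moments M"
proof (intro ext set_eqI)
  fix A \<phi>
  interpret F: moment_category C "factorisation_system_of C M" by (rule moment_category_of)
  show "\<phi> \<in> fs_moments C (factorisation_system_of C M) A \<longleftrightarrow> \<phi> \<in> moments M A"
  proof
    assume "\<phi> \<in> fs_moments C (factorisation_system_of C M) A"
    then obtain i r where i: "i \<in> Inr (factorisation_system_of C M)" "Cod C i = A"
      "active_retraction C (factorisation_system_of C M) r i" "\<phi> = i \<cdot> r" by (rule F.fs_momentsE)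
    then have I: "i \<in> ms_inert C M" by (simp add: factorisation_system_of_def)
    then show "\<phi> \<in> moments M A"
      using i active_retraction_iff[OF I, of r] push_moment[of i "\<one> (Dom C i)"] m1
        inert_Mor[OF I] by simp
  next
    assume \<phi>: "\<phi> \<in> moments M A"
    then obtain i r where i: "retraction C r i" "Cod C i = A" "\<phi> = i \<cdot> r" by (rule momentsE)
    have m: "i \<cdot> r \<in> moments M (Cod C i)" using \<phi> i by simp
    have "i \<in> ms_inert C M" using inert_of_split_moment[OF i(1) m] .
    moreover have "r \<in> ms_active C M" using retraction_active[OF i(1) m] .
    ultimately show "\<phi> \<in> fs_moments C (factorisation_system_of C M) A"
      using F.fs_momentsI[of i r] i
      by (simp add: active_retraction_def factorisation_system_of_def)
  qed
qed

text \<open>As \<open>\<phi> = i\<^sub>*(1)\<close>, axiom (m3) turns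
  \<open>f\<^sub>*(\<phi>)\<close> into \<open>(f \<cdot> i)\<^sub>*(1)\<close>, which is
  \<open>k \<cdot> s\<close> for any factorisation \<open>f \<cdot> i = k \<cdot> e\<close>.\<close>

lemma fs_push_factorisation_system_of:
  assumes f: "f \<in> Mor C" and \<phi>: "\<phi> \<in> moments M (Dom C f)"
  shows "fs_push C (factorisation_system_of C M) f \<phi> = push M f \<phi>"
proof -
  let ?F = "factorisation_system_of C M"
  interpret F: moment_category C ?F by (rule moment_category_of)
  have "\<phi> \<in> fs_moments C ?F (Dom C f)" using \<phi> by (simp add: fs_moments_factorisation_system_of)
  then obtain i r where i: "i \<in> Inr ?F" "Cod C i = Dom C f" "active_retraction C ?F r i" "\<phi> = i \<cdot> r"
    by (rule F.fs_momentsE)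
  have I: "i \<in> ms_inert C M" using i(1) by (simp add: factorisation_system_of_def)
  obtain k e s where ks: "factorises C ?F (f \<cdot> i) k e" "active_retraction C ?F s k"
    using F.factorisation_with_retraction[of "f \<cdot> i"] f i inert_Mor[OF I] by auto
  have ke: "k \<in> ms_inert C M" "e \<in> ms_active C M" "Cod C e = Dom C k" "f \<cdot> i = k \<cdot> e"
    using F.factorisesD[OF ks(1)] by (simp_all add: factorisation_system_of_def)
  have de: "Dom C e = Dom C i" using F.factorisesD(5)[OF ks(1)] f i(2) inert_Mor[OF I] by simp
  have s: "retraction C s k" "k \<cdot> s = push M k (\<one> (Dom C k))"
    using ks(2) active_retraction_iff[OF ke(1)] by simp_all
  have "push M f \<phi> = push M f (push M i (\<one> (Dom C i)))"
    using i active_retraction_iff[OF I] by simp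
  also have "\<dots> = push M (f \<cdot> i) (\<one> (Dom C i))"
    using push_comp[of i f "\<one> (Dom C i)"] f i inert_Mor[OF I] m1 by simp
  also have "\<dots> = k \<cdot> s" using push_ide_factorised[OF ke(1,2,3) s] ke(4) de by simp
  finally show ?thesis using F.fs_push_eq[OF f i(1,2,3) ks] i(4) by simp
qed

lemma moment_structure_of_factorisation_system_of:
  "moment_structure_of C (factorisation_system_of C M) = M"
proof -
  have "(\<lambda>f \<in> Mor C. \<lambda>\<phi> \<in> moments M (Dom C f). fs_push C (factorisation_system_of C M) f \<phi>) f
      = push M f" for f
  proof (cases "f \<in> Mor C")
    case True
    \<comment> \<open>Equality of records needs agreement off the moments too; there both sides are
      \<open>undefined\<close>.\<close>
    then have "push M f \<in> extensional (moments M (Dom C f))"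
      using push_fun[of f "Dom C f" "Cod C f"] by (auto simp: hom_def PiE_def)
    with True show ?thesis
      by (auto simp: fs_push_factorisation_system_of restrict_def extensional_def)
  next
    case False
    then show ?thesis using push_outside by (simp add: extensional_def)
  qed
  then have "(\<lambda>f \<in> Mor C. \<lambda>\<phi> \<in> moments M (Dom C f). fs_push C (factorisation_system_of C M) f \<phi>)
      = push M" by blast
  then show ?thesis
    by (simp add: moment_structure_of_def fs_moments_factorisation_system_of)
qed

end

theorem proposition1p5:
  fixes C :: "('o, 'm) category_data"
  assumes "category C"
  shows "bij_betw (moment_structure_of C) {F. moment_category C F} {M. split_moment_structure C M}
    \<and> bij_betw (factorisation_system_of C) {M. split_moment_structure C M} {F. moment_category C F}
    \<and> (\<forall>F. moment_category C F \<longrightarrow> factorisation_system_of C (moment_structure_of C F) = F)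
    \<and> (\<forall>M. split_moment_structure C M \<longrightarrow> moment_structure_of C (factorisation_system_of C M) = M)"
proof -
  note FM = moment_category.split_moment_structure_of
    moment_category.factorisation_system_of_moment_structure_of
  note MF = split_moment_structure.moment_category_of
    split_moment_structure.moment_structure_of_factorisation_system_of
  have "bij_betw (moment_structure_of C) {F. moment_category C F} {M. split_moment_structure C M}"
    by (rule bij_betw_byWitness[where f' = "factorisation_system_of C"]) (auto simp: FM MF)
  moreover have
    "bij_betw (factorisation_system_of C) {M. split_moment_structure C M} {F. moment_category C F}"
    by (rule bij_betw_byWitness[where f' = "moment_structure_of C"]) (auto simp: FM MF)
  ultimately show ?thesis by (simp add: FM MF)
qed

end
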